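(* Let $\Sigma$ be a two-dimensional integer multiplicity rectifiable varifold of finite mass in the closed unit ball $B^n\subset\mathbb{R}^n$ which is stationary for deformations that preserve the ball, and let $f:B^n\to B^n$ be a conformal transformation of the ball. Then the boundary length is reduced under $f$: $$|f(\partial\Sigma)|\le|\partial\Sigma| .$$
   Context: "Stationary for deformations that preserve the ball" means that $\int \mathrm{div}_{S}X(x)\,d\Sigma(x,S)=0$ for every $C^1$ vector field $X$ on $\mathbb{R}^n$ with $X(x)\cdot x=0$ for all $|x|=1$; here $\mathrm{div}_S X=\sum_i \nabla_{e_i}X\cdot e_i$ for an orthonormal basis $e_1,e_2$ of the plane $S$. The boundary measure of such a $\Sigma$ is the finite nonnegative Borel measure $\mu$ on $\partial B^n$ given by the first variation formula $$\int \mathrm{div}_{S}X(x)\,d\Sigma(x,S)=\int_{\partial B^n}X\cdot x\,d\mu(x)\qquad\text{for all }C^1\text{ vector fields }X\text{ on }\mathbb{R}^n .$$ (For a smooth minimal surface meeting $\partial B^n$ orthogonally, $\mu$ is arc length on the boundary curve.) The boundary length is $|\partial\Sigma|=\mu(\partial B^n)$. For a conformal transformation (Möbius self-diffeomorphism) $f$ of $B^n$, let $u>0$ be its length magnification factor, $f^*\delta=u^2\delta$ with $\delta$ the Euclidean metric; then $|f(\partial\Sigma)|=\int_{\partial B^n}u\,d\mu$. *)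

theory Defs
  imports "HOL-Analysis.Analysis"
begin

definition hausdorff2_pre :: "real \<Rightarrow> 'a::metric_space set \<Rightarrow> ennreal" where
  "hausdorff2_pre \<delta> A =
     (INF C \<in> {C :: nat \<Rightarrow> 'a set.
                A \<subseteq> (\<Union>j. C j) \<and> (\<forall>j. bounded (C j) \<and> diameter (C j) \<le> \<delta>)}.
        \<Sum>j. ennreal (pi * (diameter (C j) / 2)\<^sup>2))"

definition hausdorff2_outer :: "'a::metric_space set \<Rightarrow> ennreal" where
  "hausdorff2_outer A = (SUP \<delta> \<in> {0<..}. hausdorff2_pre \<delta> A)"

text \<open>The normalisation is that of the area of a disc. The measure lives on the Caratheodory-measurable sets, which include the Borel sets.\<close>

definition hausdorff2 :: "'a::metric_space measure" where
  "hausdorff2 =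
     measure_of UNIV (lambda_system UNIV (Pow UNIV) hausdorff2_outer) hausdorff2_outer"

text \<open>The Grassmannian of 2-planes through the origin carries the topology induced by
  identifying a plane with its orthogonal projection (the nearest-point map), in operator norm.\<close>

definition grassmannian2 :: "'a::euclidean_space set measure" where
  "grassmannian2 =
     vimage_algebra {S. subspace S \<and> dim S = 2} (\<lambda>S. Blinfun (closest_point S)) borel"

definition countably_rectifiable2 :: "'a::euclidean_space set \<Rightarrow> bool" where
  "countably_rectifiable2 M \<longleftrightarrow>
     (\<exists>N (F :: nat \<Rightarrow> real^2 \<Rightarrow> 'a).
        hausdorff2_outer N = 0 \<and> (\<forall>j. \<exists>L. L-lipschitz_on UNIV (F j)) \<and>
        M \<subseteq> N \<union> (\<Union>j. range (F j)))"

text \<open>\<open>P\<close> is the approximate tangent plane of \<open>\<nu>\<close> at \<open>x\<close> with multiplicity \<open>t\<close>: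
  the rescalings of \<open>\<nu>\<close> around \<open>x\<close> converge to \<open>t\<close> times the area measure of \<open>P\<close>,
  tested against continuous functions of compact support.\<close>

definition approx_tangent2 ::
    "'a::euclidean_space measure \<Rightarrow> 'a \<Rightarrow> real \<Rightarrow> 'a set \<Rightarrow> bool" where
  "approx_tangent2 \<nu> x t P \<longleftrightarrow>
     subspace P \<and> dim P = 2 \<and>
     (\<forall>\<phi> :: 'a \<Rightarrow> real. continuous_on UNIV \<phi> \<and> compact (closure {y. \<phi> y \<noteq> 0}) \<longrightarrow>
        ((\<lambda>r. (\<integral>z. \<phi> ((z - x) /\<^sub>R r) \<partial>\<nu>) / r\<^sup>2)
           \<longlongrightarrow> t * set_lebesgue_integral hausdorff2 P \<phi>) (at_right 0))"

definition weight2 :: "'a::euclidean_space set \<Rightarrow> ('a \<Rightarrow> nat) \<Rightarrow> 'a measure" where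
  "weight2 M \<theta> = density (restrict_space hausdorff2 M) (\<lambda>x. of_nat (\<theta> x))"

text \<open>A varifold is a Borel measure on the product of the ambient space with the Grassmannian.
  The field \<open>T\<close> of approximate tangent planes is determined almost everywhere by
  \<open>M\<close> and \<open>\<theta>\<close>.\<close>

definition integer_rectifiable_varifold2 ::
    "('a::euclidean_space \<times> 'a set) measure \<Rightarrow> bool" where
  "integer_rectifiable_varifold2 V \<longleftrightarrow>
     (\<exists>M \<theta> T.
        M \<in> sets hausdorff2 \<and> countably_rectifiable2 M \<and>
        \<theta> \<in> restrict_space hausdorff2 M \<rightarrow>\<^sub>M count_space (UNIV :: nat set) \<and>
        (\<forall>x\<in>M. 1 \<le> \<theta> x) \<and>
        (\<forall>K. compact K \<longrightarrow> emeasure (weight2 M \<theta>) (K \<inter> M) < \<infinity>) \<and>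
        T \<in> restrict_space hausdorff2 M \<rightarrow>\<^sub>M grassmannian2 \<and>
        (AE x in restrict_space hausdorff2 M.
           approx_tangent2 (weight2 M \<theta>) x (real (\<theta> x)) (T x)) \<and>
        V = distr (weight2 M \<theta>) (borel \<Otimes>\<^sub>M grassmannian2) (\<lambda>x. (x, T x)))"

definition C1_field :: "('a::euclidean_space \<Rightarrow> 'a) \<Rightarrow> bool" where
  "C1_field X \<longleftrightarrow>
     (\<exists>X' :: 'a \<Rightarrow> 'a \<Rightarrow>\<^sub>L 'a.
        (\<forall>x. (X has_derivative blinfun_apply (X' x)) (at x)) \<and> continuous_on UNIV X')"

definition orthonormal_basis_of :: "'a::euclidean_space set \<Rightarrow> 'a set \<Rightarrow> bool" where
  "orthonormal_basis_of S E \<longleftrightarrow>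
     finite E \<and> pairwise orthogonal E \<and> (\<forall>e\<in>E. norm e = 1) \<and> span E = S"

definition plane_div :: "'a::euclidean_space set \<Rightarrow> ('a \<Rightarrow> 'a) \<Rightarrow> 'a \<Rightarrow> real" where
  "plane_div S X x =
     (\<Sum>e \<in> (SOME E. orthonormal_basis_of S E). frechet_derivative X (at x) e \<bullet> e)"

definition first_variation ::
    "('a::euclidean_space \<times> 'a set) measure \<Rightarrow> ('a \<Rightarrow> 'a) \<Rightarrow> real" where
  "first_variation V X = (\<integral>(x, S). plane_div S X x \<partial>V)"

definition ball_stationary :: "('a::euclidean_space \<times> 'a set) measure \<Rightarrow> bool" where
  "ball_stationary V \<longleftrightarrow>
     (\<forall>X. C1_field X \<and> (\<forall>x. norm x = 1 \<longrightarrow> X x \<bullet> x = 0) \<longrightarrow> first_variation V X = 0)"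

definition is_boundary_measure ::
    "('a::euclidean_space \<times> 'a set) measure \<Rightarrow> 'a measure \<Rightarrow> bool" where
  "is_boundary_measure V \<mu> \<longleftrightarrow>
     sets \<mu> = sets (restrict_space borel (sphere 0 1)) \<and> finite_measure \<mu> \<and>
     (\<forall>X. C1_field X \<longrightarrow> first_variation V X = (\<integral>x. X x \<bullet> x \<partial>\<mu>))"

text \<open>The one-point compactification is modelled by \<open>'a option\<close>, with \<open>None\<close> as
  the point at infinity.\<close>

fun sphere_inversion :: "'a::euclidean_space \<Rightarrow> real \<Rightarrow> 'a option \<Rightarrow> 'a option" where
  "sphere_inversion c r None = Some c"
| "sphere_inversion c r (Some x) =
     (if x = c then None else Some (c + (r\<^sup>2 / (norm (x - c))\<^sup>2) *\<^sub>R (x - c)))"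

fun hyperplane_reflection :: "'a::euclidean_space \<Rightarrow> real \<Rightarrow> 'a option \<Rightarrow> 'a option" where
  "hyperplane_reflection a t None = None"
| "hyperplane_reflection a t (Some x) = Some (x - (2 * (a \<bullet> x - t)) *\<^sub>R a)"

inductive moebius :: "('a::euclidean_space option \<Rightarrow> 'a option) \<Rightarrow> bool" where
  moebius_id: "moebius id"
| moebius_inversion: "r > 0 \<Longrightarrow> moebius g \<Longrightarrow> moebius (sphere_inversion c r \<circ> g)"
| moebius_reflection: "norm a = 1 \<Longrightarrow> moebius g \<Longrightarrow> moebius (hyperplane_reflection a t \<circ> g)"

definition ball_conformal :: "('a::euclidean_space \<Rightarrow> 'a) \<Rightarrow> bool" where
  "ball_conformal f \<longleftrightarrow>
     f ` cball 0 1 = cball 0 1 \<and>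
     (\<exists>g. moebius g \<and> (\<forall>x\<in>cball 0 1. g (Some x) = Some (f x)))"

text \<open>The pullback by \<open>f\<close> of the Euclidean metric is \<open>u\<^sup>2\<close> times the Euclidean metric on
  the closed ball; at boundary points the derivative is taken from inside the ball.\<close>

definition length_magnification ::
    "('a::euclidean_space \<Rightarrow> 'a) \<Rightarrow> ('a \<Rightarrow> real) \<Rightarrow> bool" where
  "length_magnification f u \<longleftrightarrow>
     (\<forall>x\<in>cball 0 1. u x > 0 \<and>
        (\<exists>D. (f has_derivative D) (at x within cball 0 1) \<and>
             (\<forall>v w. D v \<bullet> D w = (u x)\<^sup>2 * (v \<bullet> w))))"

definition boundary_length :: "'a::euclidean_space measure \<Rightarrow> real" where
  "boundary_length \<mu> = measure \<mu> (sphere 0 1)"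

definition image_boundary_length :: "('a::euclidean_space \<Rightarrow> real) \<Rightarrow> 'a measure \<Rightarrow> real" where
  "image_boundary_length u \<mu> = (\<integral>x. u x \<partial>\<mu>)"

end

theory Submission imports Defs begin

text \<open>With \<open>f b = 0\<close>, the magnification \<open>u\<close> on the sphere is at most the Poisson kernel
  \<open>(1 - \<bar>b\<bar>\<^sup>2) / \<bar>x - b\<bar>\<^sup>2\<close>, because \<open>\<bar>f x - f y\<bar>\<^sup>2 = u x * u y * \<bar>x - y\<bar>\<^sup>2\<close> on the closed ball.
  Let \<open>X\<close> be the gradient of \<open>log N\<close>, where \<open>N x = 1 - 2 b \<bullet> x + \<bar>b\<bar>\<^sup>2 \<bar>x\<bar>\<^sup>2\<close>. On the sphere
  \<open>X \<bullet> x\<close> is 1 minus the Poisson kernel. The Hessian of \<open>N\<close> is \<open>2 \<bar>b\<bar>\<^sup>2\<close> times the identity and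
  \<open>\<bar>grad N\<bar>\<^sup>2 = 4 \<bar>b\<bar>\<^sup>2 N\<close>, so the divergence of \<open>X\<close> along any 2-plane is nonnegative, and the
  first variation formula applied to \<open>X\<close> gives the inequality.\<close>

section \<open>Moebius maps and distances in the one-point compactification\<close>

text \<open>The values at infinity are chosen so that a Moebius map \<open>g\<close> satisfies
  \<open>ext_dist (g p) (g q) = k p * k q * ext_dist p q\<close> for a positive weight \<open>k\<close>, without exception
  for poles.\<close>

fun ext_dist :: "'a::euclidean_space option \<Rightarrow> 'a option \<Rightarrow> real" where
  "ext_dist (Some x) (Some y) = dist x y"
| "ext_dist None (Some y) = 1"
| "ext_dist (Some x) None = 1"
| "ext_dist None None = 0"

lemma dist_inversion:
  fixes x y c :: "'a::euclidean_space"
  assumes "x \<noteq> c" "y \<noteq> c"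
  shows "dist (c + (r\<^sup>2 / (norm (x - c))\<^sup>2) *\<^sub>R (x - c)) (c + (r\<^sup>2 / (norm (y - c))\<^sup>2) *\<^sub>R (y - c))
    = r\<^sup>2 * dist x y / (norm (x - c) * norm (y - c))"
proof -
  define a b where "a = x - c" and "b = y - c"
  have nz: "norm a \<noteq> 0" "norm b \<noteq> 0" using assms by (auto simp: a_def b_def)
  have sq: "(norm (v - w))\<^sup>2 = (norm v)\<^sup>2 - 2 * (v \<bullet> w) + (norm w)\<^sup>2" for v w :: 'a
    by (simp add: power2_norm_eq_inner inner_diff inner_commute algebra_simps)
  have "(norm ((r\<^sup>2 / (norm a)\<^sup>2) *\<^sub>R a - (r\<^sup>2 / (norm b)\<^sup>2) *\<^sub>R b))\<^sup>2
      = (r\<^sup>2 * norm (a - b) / (norm a * norm b))\<^sup>2"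
    unfolding power_divide power_mult_distrib sq
    using nz by (simp add: power_mult_distrib power_divide field_simps power2_eq_square)
  then have "norm ((r\<^sup>2 / (norm a)\<^sup>2) *\<^sub>R a - (r\<^sup>2 / (norm b)\<^sup>2) *\<^sub>R b)
      = r\<^sup>2 * norm (a - b) / (norm a * norm b)"
    by (rule power2_eq_imp_eq) auto
  then show ?thesis by (simp add: a_def b_def dist_norm)
qed

lemma dist_inversion_center:
  fixes x c :: "'a::euclidean_space"
  assumes "x \<noteq> c"
  shows "dist (c + (r\<^sup>2 / (norm (x - c))\<^sup>2) *\<^sub>R (x - c)) c = r\<^sup>2 / norm (x - c)"
  using assms by (simp add: dist_norm power2_eq_square)

lemma ext_dist_sphere_inversion:
  fixes c :: "'a::euclidean_space"
  assumes "r > 0"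
  obtains k where "\<And>p. k p > 0"
    "\<And>p q. ext_dist (sphere_inversion c r p) (sphere_inversion c r q) = k p * k q * ext_dist p q"
proof
  \<comment> \<open>At an ordinary point the weight is the square root of the conformal factor of
    the inversion. The pair \<open>None\<close>, \<open>Some x\<close> forces the value
    \<open>r\<close> at infinity, since the image of \<open>x\<close> lies at distance
    \<open>r * (r / norm (x - c))\<close> from \<open>c\<close>; the pair \<open>Some c\<close>,
    \<open>None\<close> then forces \<open>1 / r\<close> at the centre.\<close>
  let ?k = "\<lambda>p. case p of None \<Rightarrow> r | Some x \<Rightarrow> if x = c then 1 / r else r / norm (x - c)"
  show "?k p > 0" for p
    using assms by (auto split: option.split)
  show "ext_dist (sphere_inversion c r p) (sphere_inversion c r q) = ?k p * ?k q * ext_dist p q" for p q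
    using assms
    by (cases p; cases q)
       (auto simp: dist_inversion dist_inversion_center dist_commute[of c] simp del: dist_add_cancel,
        auto simp: power2_eq_square dist_norm)
qed

lemma ext_dist_hyperplane_reflection:
  fixes a :: "'a::euclidean_space"
  assumes "norm a = 1"
  shows "ext_dist (hyperplane_reflection a t p) (hyperplane_reflection a t q) = ext_dist p q"
proof -
  have "norm (v - (2 * (a \<bullet> v)) *\<^sub>R a) = norm v" for v
  proof -
    have "a \<bullet> a = 1" using assms by (simp add: norm_eq_1)
    then have "(norm (v - (2 * (a \<bullet> v)) *\<^sub>R a))\<^sup>2 = (norm v)\<^sup>2"
      unfolding power2_norm_eq_inner
      by (simp add: inner_diff inner_commute algebra_simps)
    then show ?thesis by (rule power2_eq_imp_eq) auto
  qed
  from this[of "x - y" for x y] show ?thesis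
    by (cases p; cases q) (auto simp: dist_norm inner_diff algebra_simps)
qed

text \<open>Weights multiply along a composition as in the chain rule. Since poles are no exception,
  a map that is finite on the ball may be composed of factors that pass through infinity.\<close>

lemma moebius_ext_dist:
  fixes g :: "'a::euclidean_space option \<Rightarrow> 'a option"
  assumes "moebius g"
  shows "\<exists>k. (\<forall>p. k p > 0) \<and> (\<forall>p q. ext_dist (g p) (g q) = k p * k q * ext_dist p q)"
  using assms
proof induction
  case moebius_id
  then show ?case by (intro exI[of _ "\<lambda>_. 1"]) auto
next
  case (moebius_inversion r g c)
  obtain k where k: "\<And>p. k p > 0" "\<And>p q. ext_dist (g p) (g q) = k p * k q * ext_dist p q"
    using moebius_inversion by blast
  obtain l where l: "\<And>p. l p > 0"
    "\<And>p q. ext_dist (sphere_inversion c r p) (sphere_inversion c r q) = l p * l q * ext_dist p q"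
    using ext_dist_sphere_inversion[OF \<open>r > 0\<close>, of c] by blast
  show ?case
    using k l by (intro exI[of _ "\<lambda>p. l (g p) * k p"]) auto
next
  case (moebius_reflection a g t)
  then show ?case by (auto simp: ext_dist_hyperplane_reflection)
qed

lemma ball_conformal_dist:
  fixes f :: "'a::euclidean_space \<Rightarrow> 'a"
  assumes "ball_conformal f"
  obtains k where "\<And>x. k x > 0"
    "\<And>x y. x \<in> cball 0 1 \<Longrightarrow> y \<in> cball 0 1 \<Longrightarrow> dist (f x) (f y) = k x * k y * dist x y"
proof -
  obtain g where g: "moebius g" "\<And>x. x \<in> cball 0 1 \<Longrightarrow> g (Some x) = Some (f x)"
    using assms unfolding ball_conformal_def by blast
  obtain k where k: "\<And>p. k p > 0" "\<And>p q. ext_dist (g p) (g q) = k p * k q * ext_dist p q"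
    using moebius_ext_dist[OF g(1)] by blast
  show ?thesis
  proof
    show "k (Some x) > 0" for x using k by simp
    fix x y :: 'a assume "x \<in> cball 0 1" "y \<in> cball 0 1"
    then show "dist (f x) (f y) = k (Some x) * k (Some y) * dist x y"
      using k(2)[of "Some x" "Some y"] g(2) by simp
  qed
qed

section \<open>The magnification factor and distances in the closed ball\<close>

lemma continuous_on_ball_conformal:
  assumes "length_magnification f u"
  shows "continuous_on (cball 0 1) f"
  using assms unfolding length_magnification_def continuous_on_eq_continuous_within
  by (meson has_derivative_continuous)

text \<open>The derivative scales every norm by \<open>u x\<close>, so the quotient differs from
  \<open>u x\<close> by at most the normalised remainder.\<close>

lemma length_magnification_dist_quotient:
  assumes "length_magnification f u" "x \<in> cball 0 1"
  shows "((\<lambda>y. dist (f y) (f x) / dist y x) \<longlongrightarrow> u x) (at x within cball 0 1)"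
proof -
  obtain D where D: "(f has_derivative D) (at x within cball 0 1)"
      "\<And>v w. D v \<bullet> D w = (u x)\<^sup>2 * (v \<bullet> w)" and pos: "u x > 0"
    using assms unfolding length_magnification_def by blast
  have normD: "norm (D v) = u x * norm v" for v
  proof -
    have "(norm (D v))\<^sup>2 = (u x * norm v)\<^sup>2"
      using D(2)[of v v] by (simp add: power_mult_distrib power2_norm_eq_inner)
    then show ?thesis by (rule power2_eq_imp_eq) (use pos in auto)
  qed
  have lim: "((\<lambda>y. (f y - f x - D (y - x)) /\<^sub>R norm (y - x)) \<longlongrightarrow> 0) (at x within cball 0 1)"
    using D(1) unfolding has_derivative_at_within by simp
  have "((\<lambda>y. dist (f y) (f x) / dist y x - u x) \<longlongrightarrow> 0) (at x within cball 0 1)"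
  proof (rule Lim_null_comparison[OF _ tendsto_norm_zero[OF lim]])
    show "\<forall>\<^sub>F y in at x within cball 0 1. norm (dist (f y) (f x) / dist y x - u x)
        \<le> norm ((f y - f x - D (y - x)) /\<^sub>R norm (y - x))"
      unfolding eventually_at_filter
    proof (intro always_eventually allI impI)
      fix y assume "y \<noteq> x"
      then have n: "norm (y - x) > 0" by simp
      have "dist (f y) (f x) / dist y x - u x
          = (norm (f y - f x) - norm (D (y - x))) / norm (y - x)"
        using n by (simp add: normD dist_norm field_simps)
      then have "norm (dist (f y) (f x) / dist y x - u x)
          = \<bar>norm (f y - f x) - norm (D (y - x))\<bar> / norm (y - x)"
        by simp
      also have "\<dots> \<le> norm (f y - f x - D (y - x)) / norm (y - x)"
        using n by (intro divide_right_mono norm_triangle_ineq3) auto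
      finally show "norm (dist (f y) (f x) / dist y x - u x)
        \<le> norm ((f y - f x - D (y - x)) /\<^sub>R norm (y - x))"
        by (simp add: divide_inverse mult.commute)
    qed
  qed
  then show ?thesis by (simp add: LIM_zero_iff)
qed

text \<open>The weight \<open>k\<close> of the Moebius map satisfies
  \<open>u x = (k x)\<^sup>2\<close>: the quotient \<open>dist (f y) (f x) / dist y x\<close> is
  \<open>k y * k x\<close> and tends to \<open>u x\<close>, so what remains is the continuity of
  \<open>k\<close> at \<open>x\<close>.\<close>

lemma dist_length_magnification:
  fixes f :: "'a::euclidean_space \<Rightarrow> 'a"
  assumes "ball_conformal f" and L: "length_magnification f u"
    and "x \<in> cball 0 1" "y \<in> cball 0 1"
  shows "(dist (f x) (f y))\<^sup>2 = u x * u y * (dist x y)\<^sup>2"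
proof -
  obtain k where kpos: "\<And>x. k x > 0" and
    k: "\<And>x y. x \<in> cball 0 1 \<Longrightarrow> y \<in> cball 0 1 \<Longrightarrow> dist (f x) (f y) = k x * k y * dist x y"
    using ball_conformal_dist[OF assms(1)] by blast
  have "u x = (k x)\<^sup>2" if x: "x \<in> cball 0 1" for x
  proof -
    let ?F = "at x within cball 0 1"
    obtain e :: 'a where e: "norm e = 1" using vector_choose_size[of 1] by auto
    \<comment> \<open>A fixed second point \<open>z\<close> writes \<open>k y\<close> as
      \<open>dist (f y) (f z) / (k z * dist y z)\<close>, which is continuous at \<open>x\<close>
      because \<open>z\<close> differs from \<open>x\<close>.\<close>
    obtain z where z: "z \<in> cball 0 1" "z \<noteq> x"
    proof (cases "x = e")
      case True with e show ?thesis by (intro that[of 0]) auto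
    next
      case False with e show ?thesis by (intro that[of e]) auto
    qed
    have f: "(f \<longlongrightarrow> f x) ?F"
      using continuous_on_ball_conformal[OF L] x by (simp add: continuous_on_def)
    have "((\<lambda>y. dist (f y) (f z) / (k z * dist y z)) \<longlongrightarrow> dist (f x) (f z) / (k z * dist x z)) ?F"
      using z kpos[of z] by (intro tendsto_intros f) auto
    also have "dist (f x) (f z) / (k z * dist x z) = k x"
      using z kpos[of z] x by (simp add: k)
    finally have lim: "((\<lambda>y. dist (f y) (f z) / (k z * dist y z)) \<longlongrightarrow> k x) ?F" .
    have "(k \<longlongrightarrow> k x) ?F"
    proof (rule Lim_transform_eventually[OF lim])
      have "\<forall>\<^sub>F y in ?F. y \<noteq> z"
        using z(2) by (metis eventually_neq_at_within)
      moreover have "\<forall>\<^sub>F y in ?F. y \<in> cball 0 1"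
        by (auto simp: eventually_at_filter)
      ultimately show "\<forall>\<^sub>F y in ?F. dist (f y) (f z) / (k z * dist y z) = k y"
        by eventually_elim (use z kpos[of z] in \<open>simp add: k\<close>)
    qed
    then have "((\<lambda>y. k y * k x) \<longlongrightarrow> k x * k x) ?F"
      by (intro tendsto_intros)
    moreover have "\<forall>\<^sub>F y in ?F. dist (f y) (f x) / dist y x = k y * k x"
      unfolding eventually_at_filter using x by (intro always_eventually) (auto simp: k)
    ultimately have "((\<lambda>y. dist (f y) (f x) / dist y x) \<longlongrightarrow> k x * k x) ?F"
      by (simp add: tendsto_cong)
    \<comment> \<open>Limits are unique because no point of the closed ball, boundary points
      included, is isolated in it.\<close>
    moreover have "?F \<noteq> bot"
      using x islimpt_subset[OF _ ball_subset_cball, of x "0 :: 'a" 1]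
      by (simp add: trivial_limit_within islimpt_ball)
    ultimately show ?thesis
      using tendsto_unique length_magnification_dist_quotient[OF L x] 
      by (metis power2_eq_square)
  qed
  then show ?thesis
    using assms k by (simp add: power_mult_distrib)
qed

text \<open>By invariance of domain the inverse of \<open>f\<close> maps the open ball to an open
  subset of the closed ball, hence into the open ball. So a boundary point cannot have an interior
  image.\<close>

lemma ball_conformal_sphere:
  fixes f :: "'a::euclidean_space \<Rightarrow> 'a"
  assumes B: "ball_conformal f" and L: "length_magnification f u" and "norm x = 1"
  shows "norm (f x) = 1"
proof (rule ccontr)
  assume ne: "norm (f x) \<noteq> 1"
  have upos: "u x > 0" if "x \<in> cball 0 1" for x
    using L that unfolding length_magnification_def by blast
  have img: "f ` cball 0 1 = cball 0 1" using B unfolding ball_conformal_def by blast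
  have inj: "inj_on f (cball 0 1)"
  proof (rule inj_onI)
    fix x y assume xy: "x \<in> cball 0 1" "y \<in> cball 0 1" "f x = f y"
    then show "x = y"
      using dist_length_magnification[OF B L xy(1,2)] upos[OF xy(1)] upos[OF xy(2)] by simp
  qed
  have xin: "x \<in> cball 0 1" using assms(3) by simp
  then have fx: "f x \<in> ball 0 1" using img ne by force
  let ?h = "the_inv_into (cball 0 1) f"
  have "continuous_on (cball 0 1) ?h"
    using continuous_on_inv_into[OF continuous_on_ball_conformal[OF L] compact_cball inj] img by simp
  moreover have "inj_on ?h (cball 0 1)"
    using inj_on_the_inv_into[OF inj] img by simp
  ultimately have "open (?h ` ball 0 1)"
    by (intro invariance_of_domain) (auto intro: continuous_on_subset inj_on_subset)
  moreover have "?h ` ball 0 1 \<subseteq> cball 0 1"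
    using the_inv_into_into[OF inj _ order_refl] img by force
  ultimately have "?h ` ball 0 1 \<subseteq> ball 0 1"
    using interior_maximal interior_cball by metis
  moreover have "?h (f x) = x" using the_inv_into_f_f[OF inj xin] .
  ultimately have "x \<in> ball 0 1" using fx by (metis image_subset_iff)
  with assms(3) show False by simp
qed

text \<open>Take \<open>b\<close> with \<open>f b = 0\<close>. As \<open>f x\<close> has norm 1, the
  distance identity for \<open>x\<close> and \<open>b\<close> determines \<open>u x\<close> as
  \<open>1 / (u b * (norm (x - b))\<^sup>2)\<close>, and it remains to see that
  \<open>1 / u b\<close> is at most \<open>1 - (norm b)\<^sup>2\<close>.\<close>

lemma length_magnification_le_Poisson:
  fixes f :: "'a::euclidean_space \<Rightarrow> 'a"
  assumes B: "ball_conformal f" and L: "length_magnification f u"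
  obtains b where "norm b < 1"
    "\<And>x. norm x = 1 \<Longrightarrow> u x \<le> (1 - (norm b)\<^sup>2) / (norm (x - b))\<^sup>2"
proof -
  have upos: "u x > 0" if "norm x \<le> 1" for x
    using L that unfolding length_magnification_def by simp
  have "0 \<in> f ` cball 0 1" using B unfolding ball_conformal_def by simp
  then obtain b where b: "norm b \<le> 1" "f b = 0" by auto
  have "norm b \<noteq> 1" using ball_conformal_sphere[OF B L, of b] b by auto
  with b have b1: "norm b < 1" by simp
  have u: "u x = 1 / (u b * (norm (x - b))\<^sup>2)" if x: "norm x = 1" for x
  proof -
    have "u x * u b * (norm (x - b))\<^sup>2 = 1"
      using dist_length_magnification[OF B L, of x b] x b ball_conformal_sphere[OF B L x]
      by (simp add: dist_norm)
    moreover have "x \<noteq> b" using x b1 by auto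
    ultimately show ?thesis using upos[OF b(1)] by (simp add: eq_divide_eq mult.assoc)
  qed
  \<comment> \<open>The ends of the diameter through \<open>b\<close> have images at distance at most 2,
    which bounds \<open>u b\<close> from below.\<close>
  obtain e where e: "norm e = 1" "b = norm b *\<^sub>R e"
  proof (cases "b = 0")
    case True
    obtain e :: 'a where "norm e = 1" using vector_choose_size[of 1] by auto
    with True that show ?thesis by simp
  next
    case False then show ?thesis by (intro that[of "sgn b"]) (auto simp: norm_sgn sgn_div_norm)
  qed
  have "e - b = (1 - norm b) *\<^sub>R e" "- e - b = - ((1 + norm b) *\<^sub>R e)"
    using e(2) by (metis scaleR_left_diff_distrib scaleR_one)
      (metis e(2) minus_add_distrib scaleR_left_distrib scaleR_one add_uminus_conv_diff)
  then have n: "norm (e - b) = 1 - norm b" "norm (- e - b) = 1 + norm b"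
    using e(1) b1 by simp_all
  have "dist (f e) (f (- e)) \<le> norm (f e) + norm (f (- e))"
    by (simp add: dist_norm norm_triangle_ineq4)
  also have "\<dots> = 2" using ball_conformal_sphere[OF B L] e(1) by simp
  finally have "(dist (f e) (f (- e)))\<^sup>2 \<le> 2\<^sup>2" by (intro power_mono) auto
  moreover have "dist e (- e) = 2"
    using e(1) by (simp add: dist_norm flip: scaleR_2)
  ultimately have le: "u e * u (- e) \<le> 1"
    using dist_length_magnification[OF B L, of e "- e"] e(1) by simp
  let ?s = "1 - (norm b)\<^sup>2"
  have s: "?s > 0" using b1 by (simp add: power_less_one_iff abs_square_less_1)
  have ub: "u b > 0" using upos b by simp
  \<comment> \<open>The distances of \<open>e\<close> and \<open>- e\<close> from \<open>b\<close>
    are \<open>1 - norm b\<close> and \<open>1 + norm b\<close>, with product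
    \<open>?s\<close>.\<close>
  have "u e * u (- e) = (1 / (u b * ?s))\<^sup>2"
    using e(1) by (simp add: u n power2_eq_square algebra_simps)
  with le have "\<bar>1 / (u b * ?s)\<bar> \<le> 1"
    by (simp only: abs_square_le_1)
  then have "1 \<le> u b * ?s" using s ub by (simp add: abs_mult)
  then have "1 / u b \<le> ?s" using ub by (simp add: divide_le_eq mult.commute)
  then have "u x \<le> ?s / (norm (x - b))\<^sup>2" if "norm x = 1" for x
    using divide_right_mono[of "1 / u b" ?s "(norm (x - b))\<^sup>2"] u[OF that] by simp
  with b1 that show ?thesis by blast
qed

section \<open>The gradient field of \<open>log N\<close>\<close>

text \<open>Continued below \<open>\<epsilon>\<close> by the tangent line, which makes it \<open>C\<^sup>1\<close> on the whole line.\<close>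

definition recip_ext :: "real \<Rightarrow> real \<Rightarrow> real" where
  "recip_ext \<epsilon> w = (if \<epsilon> \<le> w then 1 / w else 2 / \<epsilon> - w / \<epsilon>\<^sup>2)"

lemma recip_ext_has_derivative:
  assumes "\<epsilon> > 0"
  shows "(recip_ext \<epsilon> has_real_derivative - 1 / (max \<epsilon> w)\<^sup>2) (at w)"
proof -
  \<comment> \<open>The two closed half-lines meet at \<open>\<epsilon>\<close>, where both pieces
    have value \<open>1 / \<epsilon>\<close> and slope
    \<open>- 1 / \<epsilon>\<^sup>2\<close>.\<close>
  have "((\<lambda>w. if w \<in> {\<epsilon>..} then 1 / w else 2 / \<epsilon> - w / \<epsilon>\<^sup>2) has_vector_derivative
      (if w \<in> {\<epsilon>..} then - 1 / w\<^sup>2 else - 1 / \<epsilon>\<^sup>2)) (at w within UNIV)"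
    using assms
    by (intro has_vector_derivative_If_within_closures[where S = "{\<epsilon>..}" and T = "{..\<epsilon>}" 
        and f' = "\<lambda>w. - 1 / w\<^sup>2" and g' = "\<lambda>w. - 1 / \<epsilon>\<^sup>2"])
       (auto intro!: derivative_eq_intros simp: power2_eq_square 
         simp flip: has_real_derivative_iff_has_vector_derivative)
  then show ?thesis
    unfolding recip_ext_def has_real_derivative_iff_has_vector_derivative
    by (auto simp: max_def fun_eq_iff)
qed

text \<open>For nonzero \<open>b\<close> this is \<open>(norm b)\<^sup>2\<close> times the squared
  distance from \<open>x\<close> to the mirror image of \<open>b\<close> in the unit sphere. The
  expanded form also covers \<open>b = 0\<close>, where it is constantly 1.\<close>

definition log_potential :: "'a::euclidean_space \<Rightarrow> 'a \<Rightarrow> real" where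
  "log_potential b x = 1 - 2 * (b \<bullet> x) + (norm b)\<^sup>2 * (x \<bullet> x)"

definition potential_grad :: "'a::euclidean_space \<Rightarrow> 'a \<Rightarrow> 'a" where
  "potential_grad b x = 2 *\<^sub>R ((norm b)\<^sup>2 *\<^sub>R x - b)"

text \<open>The gradient of \<open>log N\<close>, altered near the zero of \<open>N\<close>, which lies outside the closed ball.\<close>

definition log_field :: "'a::euclidean_space \<Rightarrow> 'a \<Rightarrow> 'a" where
  "log_field b x =
     recip_ext ((1 - norm b)\<^sup>2) (log_potential b x) *\<^sub>R potential_grad b x"

text \<open>Assembled from bounded operators because \<open>C1_field\<close> asks for continuity in
  operator norm.\<close>

definition log_field_deriv :: "'a::euclidean_space \<Rightarrow> 'a \<Rightarrow> 'a \<Rightarrow>\<^sub>L 'a" where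
  "log_field_deriv b x =
     (- 1 / (max ((1 - norm b)\<^sup>2) (log_potential b x))\<^sup>2) *\<^sub>R
        (blinfun_scaleR_left (potential_grad b x) o\<^sub>L blinfun_inner_right (potential_grad b x))
     + (recip_ext ((1 - norm b)\<^sup>2) (log_potential b x) * (2 * (norm b)\<^sup>2)) *\<^sub>R id_blinfun"

lemma log_potential_has_derivative:
  "(log_potential b has_derivative (\<lambda>h. potential_grad b x \<bullet> h)) (at x)"
  unfolding log_potential_def potential_grad_def
  by (auto intro!: derivative_eq_intros simp: inner_diff algebra_simps inner_commute)

lemma log_field_has_derivative:
  assumes "norm b < 1"
  shows "(log_field b has_derivative blinfun_apply (log_field_deriv b x)) (at x)"
proof -
  let ?e = "(1 - norm b)\<^sup>2" and ?N = "log_potential b" and ?G = "potential_grad b"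
  have "?e > 0" using assms by simp
  have "((\<lambda>x. recip_ext ?e (?N x)) has_derivative
      (\<lambda>h. (?G x \<bullet> h) * (- 1 / (max ?e (?N x))\<^sup>2))) (at x)"
    using has_derivative_compose[OF log_potential_has_derivative
      recip_ext_has_derivative[OF \<open>?e > 0\<close>, unfolded has_field_derivative_def]]
    by (simp add: mult.commute)
  moreover have "(?G has_derivative (\<lambda>h. (2 * (norm b)\<^sup>2) *\<^sub>R h)) (at x)"
    unfolding potential_grad_def by (auto intro!: derivative_eq_intros)
  ultimately have "(log_field b has_derivative
      (\<lambda>h. recip_ext ?e (?N x) *\<^sub>R ((2 * (norm b)\<^sup>2) *\<^sub>R h)
        + ((?G x \<bullet> h) * (- 1 / (max ?e (?N x))\<^sup>2)) *\<^sub>R ?G x)) (at x)"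
    unfolding log_field_def by (rule has_derivative_scaleR)
  then show ?thesis
    by (rule has_derivative_eq_rhs)
       (simp add: log_field_deriv_def blinfun.add_left blinfun.diff_left blinfun.scaleR_left
          fun_eq_iff)
qed

lemma continuous_on_log_field_deriv:
  assumes "norm b < 1"
  shows "continuous_on UNIV (log_field_deriv b)"
proof -
  let ?e = "(1 - norm b)\<^sup>2"
  have "?e > 0" using assms by simp
  have N: "continuous_on UNIV (log_potential b)"
    unfolding log_potential_def by (intro continuous_intros)
  have G: "continuous_on UNIV (potential_grad b)"
    unfolding potential_grad_def by (intro continuous_intros)
  have "continuous_on UNIV (recip_ext ?e)"
    using recip_ext_has_derivative[OF \<open>?e > 0\<close>] 
    by (meson DERIV_isCont continuous_at_imp_continuous_on)
  then have R: "continuous_on UNIV (\<lambda>x. recip_ext ?e (log_potential b x))"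
    using N continuous_on_compose2 by blast
  have "max ?e w \<noteq> 0" for w using \<open>?e > 0\<close> by linarith
  then show ?thesis
    unfolding log_field_deriv_def
    by (intro continuous_intros N R G
      bounded_linear.continuous_on[OF bounded_linear_blinfun_scaleR_left]
      bounded_linear.continuous_on[OF bounded_linear_blinfun_inner_right]) auto
qed

lemma C1_field_log_field: "norm b < 1 \<Longrightarrow> C1_field (log_field b)"
  unfolding C1_field_def using log_field_has_derivative continuous_on_log_field_deriv by blast

text \<open>Cauchy-Schwarz bounds \<open>N\<close> below by
  \<open>(1 - norm b * norm x)\<^sup>2\<close>. Hence on the closed ball \<open>recip_ext\<close> is
  the true reciprocal and the alteration of the field is not felt.\<close>

lemma log_potential_ge:
  assumes "norm b < 1" "norm x \<le> 1"
  shows "(1 - norm b)\<^sup>2 \<le> log_potential b x"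
proof -
  have "norm b * norm x \<le> norm b" using assms by (simp add: mult_left_le)
  then have "(1 - norm b)\<^sup>2 \<le> (1 - norm b * norm x)\<^sup>2"
    using assms by (intro power_mono) auto
  also have "\<dots> = 1 - 2 * (norm b * norm x) + (norm b)\<^sup>2 * (x \<bullet> x)"
    by (simp add: power2_norm_eq_inner[symmetric] power2_eq_square algebra_simps)
  also have "\<dots> \<le> log_potential b x"
    using norm_cauchy_schwarz[of b x] by (simp add: log_potential_def)
  finally show ?thesis .
qed

section \<open>Divergence along 2-planes and the normal component on the sphere\<close>

lemma orthonormal_Bessel:
  fixes v :: "'a::euclidean_space"
  assumes "orthonormal_basis_of S E"
  shows "(\<Sum>e\<in>E. (v \<bullet> e)\<^sup>2) \<le> v \<bullet> v"
proof -
  have E: "finite E" "pairwise orthogonal E" "\<And>e. e \<in> E \<Longrightarrow> e \<bullet> e = 1"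
    using assms by (auto simp: orthonormal_basis_of_def norm_eq_1)
  let ?p = "\<Sum>e\<in>E. (v \<bullet> e) *\<^sub>R e"
  have pe: "?p \<bullet> e = v \<bullet> e" if "e \<in> E" for e
  proof -
    have "?p \<bullet> e = (\<Sum>d\<in>E. (v \<bullet> d) * (d \<bullet> e))" by (simp add: inner_sum_left)
    also have "\<dots> = (\<Sum>d\<in>E. if d = e then v \<bullet> d else 0)"
      using E that by (intro sum.cong) (auto simp: pairwise_def orthogonal_def)
    finally show ?thesis using E that by simp
  qed
  have "v \<bullet> ?p = (\<Sum>e\<in>E. (v \<bullet> e)\<^sup>2)"
    by (simp add: inner_sum_right power2_eq_square)
  moreover have "?p \<bullet> ?p = (\<Sum>e\<in>E. (v \<bullet> e)\<^sup>2)"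
    by (subst inner_sum_right) (auto simp: pe power2_eq_square)
  moreover have "0 \<le> (v - ?p) \<bullet> (v - ?p)" by simp
  ultimately show ?thesis by (simp add: inner_diff inner_commute)
qed

lemma ex_orthonormal_basis_of:
  fixes S :: "'a::euclidean_space set"
  assumes "subspace S"
  shows "\<exists>E. orthonormal_basis_of S E"
proof -
  obtain E where "pairwise orthogonal E" "\<And>x. x \<in> E \<Longrightarrow> norm x = 1" "independent E" "span E = S"
    using orthonormal_basis_subspace[OF assms] by metis
  then show ?thesis
    unfolding orthonormal_basis_of_def using finiteI_independent by blast
qed

lemma card_orthonormal_basis_of:
  assumes "orthonormal_basis_of S E"
  shows "card E = dim S"
proof -
  have "independent E"
    using assms unfolding orthonormal_basis_of_def
    by (metis norm_zero pairwise_orthogonal_independent zero_neq_one)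
  then show ?thesis
    using assms unfolding orthonormal_basis_of_def by (metis dim_span dim_eq_card_independent)
qed

text \<open>Summed over two basis vectors, the Hessian term gives
  \<open>4 * (norm b)\<^sup>2 / ?N\<close>, which is exactly
  \<open>(?G \<bullet> ?G) / ?N\<^sup>2\<close>; by Bessel the tangential part of the gradient term
  is no larger. The constants match because the planes have dimension 2.\<close>

lemma plane_div_log_field_nonneg:
  fixes b x :: "'a::euclidean_space"
  assumes "norm b < 1" "norm x \<le> 1" "subspace S" "dim S = 2"
  shows "0 \<le> plane_div S (log_field b) x"
proof -
  define E where "E = (SOME E. orthonormal_basis_of S E)"
  let ?N = "log_potential b x" and ?G = "potential_grad b x"
  have E: "orthonormal_basis_of S E"
    unfolding E_def using ex_orthonormal_basis_of[OF assms(3)] by (rule someI_ex)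
  then have one: "\<And>e. e \<in> E \<Longrightarrow> e \<bullet> e = 1"
    by (simp add: orthonormal_basis_of_def norm_eq_1)
  have cardE: "card E = 2" using card_orthonormal_basis_of[OF E] assms(4) by simp
  have ge: "(1 - norm b)\<^sup>2 \<le> ?N" using log_potential_ge assms by blast
  moreover have "(1 - norm b)\<^sup>2 > 0" using assms(1) by simp
  ultimately have pos: "?N > 0" by linarith
  have GG: "?G \<bullet> ?G = 4 * (norm b)\<^sup>2 * ?N"
    by (simp add: log_potential_def potential_grad_def inner_diff inner_commute algebra_simps
        power2_norm_eq_inner)
  have fd: "frechet_derivative (log_field b) (at x) = blinfun_apply (log_field_deriv b x)"
    using frechet_derivative_at[OF log_field_has_derivative[OF assms(1)]] by simp
  have "plane_div S (log_field b) x = (\<Sum>e\<in>E. blinfun_apply (log_field_deriv b x) e \<bullet> e)"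
    by (simp add: plane_div_def E_def fd)
  also have "\<dots> = (\<Sum>e\<in>E. 2 * (norm b)\<^sup>2 / ?N - (?G \<bullet> e)\<^sup>2 / ?N\<^sup>2)"
    using ge one
    by (intro sum.cong)
       (auto simp: log_field_deriv_def blinfun.diff_left blinfun.scaleR_left inner_diff_left
         recip_ext_def max_def power2_eq_square)
  also have "\<dots> = 4 * (norm b)\<^sup>2 / ?N - (\<Sum>e\<in>E. (?G \<bullet> e)\<^sup>2) / ?N\<^sup>2"
    by (simp add: sum_subtractf cardE sum_divide_distrib)
  also have "\<dots> \<ge> 4 * (norm b)\<^sup>2 / ?N - (?G \<bullet> ?G) / ?N\<^sup>2"
    using orthonormal_Bessel[OF E, of ?G] by (intro diff_left_mono divide_right_mono) auto
  also have "4 * (norm b)\<^sup>2 / ?N - (?G \<bullet> ?G) / ?N\<^sup>2 = 0"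
    using pos by (simp add: GG power2_eq_square)
  finally show ?thesis .
qed

text \<open>On the sphere \<open>N\<close> equals \<open>(norm (x - b))\<^sup>2\<close>, and
  \<open>2 * (norm b)\<^sup>2 - 2 * (b \<bullet> x)\<close> is this minus
  \<open>1 - (norm b)\<^sup>2\<close>.\<close>

lemma log_field_normal_component:
  fixes b x :: "'a::euclidean_space"
  assumes "norm b < 1" "norm x = 1"
  shows "log_field b x \<bullet> x = 1 - (1 - (norm b)\<^sup>2) / (norm (x - b))\<^sup>2"
proof -
  have xx: "x \<bullet> x = 1" using assms(2) by (simp add: norm_eq_1)
  have N: "log_potential b x = (norm (x - b))\<^sup>2"
    by (simp add: log_potential_def power2_norm_eq_inner inner_diff inner_commute xx)
  have "x \<noteq> b" using assms by auto
  moreover have "log_field b x \<bullet> x = (2 * (norm b)\<^sup>2 - 2 * (b \<bullet> x)) / (norm (x - b))\<^sup>2"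
    using log_potential_ge[of b x] assms xx
    by (simp add: log_field_def recip_ext_def potential_grad_def inner_diff N)
  moreover have "(norm (x - b))\<^sup>2 = 1 - 2 * (b \<bullet> x) + (norm b)\<^sup>2"
    by (simp add: power2_norm_eq_inner inner_diff inner_commute xx)
  moreover have "(norm (x - b))\<^sup>2 \<noteq> 0" using \<open>x \<noteq> b\<close> by simp
  ultimately show ?thesis by (simp add: eq_divide_eq diff_divide_eq_iff)
qed

section \<open>The varifold and the comparison of boundary lengths\<close>

lemma AE_integer_rectifiable_varifold2_plane:
  assumes "integer_rectifiable_varifold2 V"
  shows "AE (x, S) in V. subspace S \<and> dim S = 2"
proof -
  \<comment> \<open>The 2-planes are the underlying set of \<open>grassmannian2\<close>, so the
    property holds at every point of \<open>space V\<close>.\<close>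
  have "space V = UNIV \<times> {S. subspace S \<and> dim S = 2}"
    using assms
    by (auto simp: integer_rectifiable_varifold2_def space_pair_measure grassmannian2_def)
  then show ?thesis using AE_space[of V] by auto
qed

theorem mainTheorem5:
  fixes V :: "('a::euclidean_space \<times> 'a set) measure"
    and \<mu> :: "'a measure"
    and f :: "'a \<Rightarrow> 'a"
    and u :: "'a \<Rightarrow> real"
  assumes "integer_rectifiable_varifold2 V"
    and "finite_measure V"
    and "AE (x, S) in V. x \<in> cball 0 1"
    and "ball_stationary V"
    and "is_boundary_measure V \<mu>"
    and "ball_conformal f"
    and "length_magnification f u"
  shows "image_boundary_length u \<mu> \<le> boundary_length \<mu>"
proof -
  obtain b :: 'a where b: "norm b < 1" and
    u: "\<And>x. norm x = 1 \<Longrightarrow> u x \<le> (1 - (norm b)\<^sup>2) / (norm (x - b))\<^sup>2"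
    using length_magnification_le_Poisson[OF assms(6,7)] by metis
  let ?P = "\<lambda>x. (1 - (norm b)\<^sup>2) / (norm (x - b))\<^sup>2"
  have sets_\<mu>: "sets \<mu> = sets (restrict_space borel (sphere 0 1))" and "finite_measure \<mu>"
    and fv: "first_variation V (log_field b) = (\<integral>x. log_field b x \<bullet> x \<partial>\<mu>)"
    using assms(5) C1_field_log_field[OF b] unfolding is_boundary_measure_def by auto
  interpret finite_measure \<mu> by fact
  have space_\<mu>: "space \<mu> = sphere 0 1"
    using sets_eq_imp_space_eq[OF sets_\<mu>] by (simp add: space_restrict_space)
  have "AE z in V. 0 \<le> (case z of (x, S) \<Rightarrow> plane_div S (log_field b) x)"
    using assms(3) AE_integer_rectifiable_varifold2_plane[OF assms(1)]
    by eventually_elim (use b in \<open>auto intro: plane_div_log_field_nonneg\<close>)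
  \<comment> \<open>No integrability is claimed: a nonintegrable integrand has integral 0, which
    also satisfies the bound.\<close>
  then have nonneg: "0 \<le> (\<integral>x. log_field b x \<bullet> x \<partial>\<mu>)"
    unfolding fv[symmetric] first_variation_def by (rule integral_nonneg_AE)
  have P_nonneg: "0 \<le> ?P x" for x
    using b by (simp add: abs_square_le_1)
  \<comment> \<open>The sphere keeps distance at least \<open>1 - norm b\<close> from
    \<open>b\<close>, so the kernel is bounded and hence integrable for the finite measure.\<close>
  have P_le: "?P x \<le> (1 - (norm b)\<^sup>2) / (1 - norm b)\<^sup>2" if "norm x = 1" for x
  proof (rule divide_left_mono)
    have "1 - norm b \<le> norm (x - b)" using norm_triangle_ineq2[of x b] that by simp
    then show "(1 - norm b)\<^sup>2 \<le> (norm (x - b))\<^sup>2" using b by (intro power_mono) auto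
    show "0 \<le> 1 - (norm b)\<^sup>2" using b by (simp add: abs_square_le_1)
    have "x \<noteq> b" using b that by auto
    then show "0 < (norm (x - b))\<^sup>2 * (1 - norm b)\<^sup>2" using b by simp
  qed
  have "integrable \<mu> ?P"
  proof (rule integrable_const_bound)
    show "AE x in \<mu>. norm (?P x) \<le> (1 - (norm b)\<^sup>2) / (1 - norm b)\<^sup>2"
      using P_le P_nonneg by (intro AE_I2) (simp only: space_\<mu> real_norm_def abs_of_nonneg mem_sphere_0)
    have "?P \<in> borel_measurable (restrict_space borel (sphere 0 1))"
      by (intro measurable_restrict_space1) measurable
    then show "?P \<in> borel_measurable \<mu>"
      using measurable_cong_sets[OF sets_\<mu> refl] by blast
  qed
  \<comment> \<open>Integrability is asked of the kernel alone: were \<open>u\<close> not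
    integrable, its integral would be 0 and \<open>P_nonneg\<close> would give the
    inequality.\<close>
  then have "(\<integral>x. u x \<partial>\<mu>) \<le> (\<integral>x. ?P x \<partial>\<mu>)"
    using u P_nonneg by (intro integral_mono_AE' AE_I2) (auto simp: space_\<mu>)
  also have "\<dots> = measure \<mu> (space \<mu>) - (\<integral>x. 1 - ?P x \<partial>\<mu>)"
    using \<open>integrable \<mu> ?P\<close> by simp
  also have "(\<integral>x. 1 - ?P x \<partial>\<mu>) = (\<integral>x. log_field b x \<bullet> x \<partial>\<mu>)"
    using b by (intro Bochner_Integration.integral_cong) (auto simp: space_\<mu> log_field_normal_component)
  also have "measure \<mu> (space \<mu>) - \<dots> \<le> measure \<mu> (sphere 0 1)"
    using nonneg by (simp add: space_\<mu>)
  finally show ?thesis by (simp add: image_boundary_length_def boundary_length_def)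
qed

end
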